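(* Let $\mathcal{F}_{Hp}$ denote the class of graphs containing a Hamiltonian path. Then for infinitely many values of $n$ we have $$M_{\mathcal{F}_{Hp}}(n)=2^{n-1}.$$ In particular, this holds whenever $n=p$ or $n=2p-1$ for some odd prime $p$.
   Context: All graphs are finite and simple. For two graphs $G,G'$ on the vertex set $[n]=\{1,\dots,n\}$, $G\oplus G'$ denotes the graph on $[n]$ whose edge set is the symmetric difference of $E(G)$ and $E(G')$. For a class $\mathcal{F}$ of graphs, a family $\mathcal{G}$ of (labeled) graphs on vertex set $[n]$ is called $\mathcal{F}$-good if $G\oplus G'\in\mathcal{F}$ for any two distinct members $G,G'\in\mathcal{G}$. $M_{\mathcal{F}}(n)$ denotes the maximum possible size of an $\mathcal{F}$-good family on vertex set $[n]$. A Hamiltonian path of a graph is a path subgraph containing all vertices of the graph. *)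

theory Defs
  imports "HOL-Library.Ramsey" "HOL-Computational_Algebra.Primes"
begin

text \<open>A graph is a pair of a vertex set and an edge set, the edges being two-element sets of
  vertices.\<close>

type_synonym 'a graph = "'a set \<times> 'a set set"

abbreviation verts :: "'a graph \<Rightarrow> 'a set" where
  "verts G \<equiv> fst G"

abbreviation edges :: "'a graph \<Rightarrow> 'a set set" where
  "edges G \<equiv> snd G"

definition simple_graph :: "'a graph \<Rightarrow> bool" where
  "simple_graph G \<longleftrightarrow> finite (verts G) \<and> edges G \<subseteq> [verts G]\<^bsup>2\<^esup>"

definition graphs_on :: "nat \<Rightarrow> nat graph set" where
  "graphs_on n = {G. simple_graph G \<and> verts G = {1..n}}"

text \<open>Only used for graphs with the same vertex set.\<close>

definition graph_sym_diff :: "'a graph \<Rightarrow> 'a graph \<Rightarrow> 'a graph" where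
  "graph_sym_diff G G' = (verts G, sym_diff (edges G) (edges G'))"

definition good_family :: "nat graph set \<Rightarrow> nat \<Rightarrow> nat graph set \<Rightarrow> bool" where
  "good_family F n \<G> \<longleftrightarrow>
     \<G> \<subseteq> graphs_on n \<and> (\<forall>G\<in>\<G>. \<forall>G'\<in>\<G>. G \<noteq> G' \<longrightarrow> graph_sym_diff G G' \<in> F)"

definition max_good :: "nat graph set \<Rightarrow> nat \<Rightarrow> nat" where
  "max_good F n = Max {card \<G> | \<G>. good_family F n \<G>}"

definition path_graph :: "'a graph \<Rightarrow> bool" where
  "path_graph P \<longleftrightarrow>
     (\<exists>xs. xs \<noteq> [] \<and> distinct xs \<and> verts P = set xs \<and>
           edges P = {{xs ! i, xs ! Suc i} | i. Suc i < length xs})"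

definition subgraph :: "'a graph \<Rightarrow> 'a graph \<Rightarrow> bool" where
  "subgraph H G \<longleftrightarrow> verts H \<subseteq> verts G \<and> edges H \<subseteq> edges G"

definition hamiltonian_path :: "'a graph \<Rightarrow> 'a graph \<Rightarrow> bool" where
  "hamiltonian_path P G \<longleftrightarrow> path_graph P \<and> subgraph P G \<and> verts G \<subseteq> verts P"

definition ham_path_graphs :: "nat graph set" where
  "ham_path_graphs = {G. simple_graph G \<and> (\<exists>P. hamiltonian_path P G)}"

text \<open>The maximum in \<^const>\<open>max_good\<close> is taken over a finite nonempty set, so it is genuine.\<close>

lemma finite_graphs_on: "finite (graphs_on n)"
proof (rule finite_subset)
  show "graphs_on n \<subseteq> {{1..n}} \<times> Pow (Pow {1..n})"
    by (force simp: graphs_on_def simple_graph_def nsets_def)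
qed simp

lemma finite_good_family_cards: "finite {card \<G> | \<G>. good_family F n \<G>}"
proof (rule finite_subset)
  show "{card \<G> | \<G>. good_family F n \<G>} \<subseteq> card ` Pow (graphs_on n)"
    by (auto simp: good_family_def)
qed (simp add: finite_graphs_on)

lemma good_family_empty: "good_family F n {}"
  by (simp add: good_family_def)

end

theory Submission
  imports Defs "HOL-Number_Theory.Cong" "HOL-Library.Disjoint_Sets" "HOL-Library.Z2"
begin

text \<open>
  The upper bound is a packing argument. The \<open>2 ^ ((n - 1) choose 2)\<close> graphs in which the
  vertex \<open>n\<close> is isolated form a family such that the symmetric difference of any two of them
  still isolates \<open>n\<close>, hence has no Hamiltonian path. If a good family contained \<open>G \<noteq> G'\<close> with
  \<open>G \<oplus> D = G' \<oplus> D'\<close> for two such graphs \<open>D\<close>, \<open>D'\<close>, then \<open>G \<oplus> G' = D \<oplus> D'\<close> would both have and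
  not have a Hamiltonian path. So all sums \<open>G \<oplus> D\<close> are different, and there are at most
  \<open>2 ^ (n choose 2)\<close> graphs, which leaves \<open>2 ^ (n - 1)\<close> for the good family
  (\<open>card_good_family_le\<close>).

  The lower bound comes from a perfect one-factorization of the complete graph on \<open>n + 1\<close>
  vertices: a partition of its edges into \<open>n\<close> perfect matchings such that the union of any two
  is a Hamiltonian cycle. Deleting one vertex leaves \<open>n\<close> disjoint matchings on \<open>n\<close> vertices, and
  the union of any two contains a Hamiltonian path. The unions of an even number of these
  matchings form a linear code of \<open>2 ^ (n - 1)\<close> graphs; a nonzero word consists of at
  least two matchings and so contains a Hamiltonian path (\<open>good_family_of_edge_classes\<close>,
  \<open>max_good_if_perfect_one_factorization\<close>).

  It remains to give perfect one-factorizations on \<open>p + 1\<close> and on \<open>2 * p\<close> vertices for an odd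
  prime \<open>p\<close>. The first lives on the residues modulo \<open>p\<close> and a point at infinity, and its
  matchings are the reflections \<open>x \<mapsto> 2 * c - x\<close>, whose fixed point \<open>c\<close> is matched with infinity.
  The second lives on two copies of the residues. Its matchings are the reflections in both
  copies, with the two copies of the fixed point matched, and the nonzero shifts
  \<open>x \<mapsto> x + d\<close> from one copy to the other. Two matchings together always generate a nonzero shift
  of the residues, and as \<open>p\<close> is prime such a shift reaches every residue.
\<close>

section \<open>Hamiltonian paths as vertex sequences\<close>

lemma ham_path_graphs_iff:
  assumes "G \<in> graphs_on n" "n > 0"
  shows "G \<in> ham_path_graphs \<longleftrightarrow>
    (\<exists>xs. distinct xs \<and> set xs = {1..n} \<and> (\<forall>i. Suc i < length xs \<longrightarrow> {xs ! i, xs ! Suc i} \<in> edges G))"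
    (is "_ \<longleftrightarrow> ?R")
proof
  assume "G \<in> ham_path_graphs"
  then show ?R
    using assms
    by (fastforce simp: ham_path_graphs_def graphs_on_def hamiltonian_path_def path_graph_def
        subgraph_def)
next
  assume ?R
  then obtain xs where xs: "distinct xs" "set xs = {1..n}"
      "\<And>i. Suc i < length xs \<Longrightarrow> {xs ! i, xs ! Suc i} \<in> edges G"
    by blast
  have "xs \<noteq> []" using xs(2) \<open>n > 0\<close> by auto
  then have "hamiltonian_path (set xs, {{xs ! i, xs ! Suc i} | i. Suc i < length xs}) G"
    using xs assms by (auto simp: hamiltonian_path_def path_graph_def subgraph_def graphs_on_def)
  then show "G \<in> ham_path_graphs"
    using assms by (auto simp: ham_path_graphs_def graphs_on_def)
qed

lemma no_isolated_vertex_if_ham_path: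
  assumes G: "G \<in> graphs_on n" "G \<in> ham_path_graphs" and "n \<ge> 2" "v \<in> {1..n}"
  shows "\<exists>e \<in> edges G. v \<in> e"
proof -
  obtain xs where xs: "distinct xs" "set xs = {1..n}"
      "\<And>i. Suc i < length xs \<Longrightarrow> {xs ! i, xs ! Suc i} \<in> edges G"
    using G \<open>n \<ge> 2\<close> by (auto simp: ham_path_graphs_iff)
  have len: "length xs = n"
    using distinct_card[OF xs(1)] xs(2) by simp
  obtain i where i: "i < length xs" "xs ! i = v"
    using assms(4) xs(2) by (metis in_set_conv_nth)
  show ?thesis
  proof (cases "Suc i < length xs")
    case True
    then show ?thesis using xs(3)[of i] i by auto
  next
    case False
    then obtain j where "i = Suc j" using i len \<open>n \<ge> 2\<close> by (cases i) auto
    then show ?thesis using xs(3)[of j] i by auto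
  qed
qed

lemma graph_sym_diff_graphs_on:
  "G \<in> graphs_on n \<Longrightarrow> G' \<in> graphs_on n \<Longrightarrow> graph_sym_diff G G' \<in> graphs_on n"
  by (auto simp: graphs_on_def simple_graph_def graph_sym_diff_def)

section \<open>The upper bound\<close>

lemma sym_diff_left_imp_eq:
  assumes "sym_diff A B = sym_diff A C"
  shows "B = C"
proof (rule set_eqI)
  fix x
  have "x \<in> sym_diff A B \<longleftrightarrow> x \<in> sym_diff A C" by (simp only: assms)
  then show "x \<in> B \<longleftrightarrow> x \<in> C" by (cases "x \<in> A") simp_all
qed

text \<open>The packing argument: adding graphs that isolate the vertex \<open>n\<close> to the members of a good
  family never produces the same graph twice.\<close>

lemma card_good_family_le:
  assumes "n \<ge> 2" and good: "good_family ham_path_graphs n \<G>"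
  shows "card \<G> \<le> 2 ^ (n - 1)"
proof -
  define D where "D = Pow ([{1..n-1}]\<^bsup>2\<^esup>)"
  have "inj_on (\<lambda>(G, E). sym_diff (edges G) E) (\<G> \<times> D)"
  proof (rule inj_onI)
    fix P P' assume P: "P \<in> \<G> \<times> D" "P' \<in> \<G> \<times> D"
      and PP': "(case P of (G, E) \<Rightarrow> sym_diff (edges G) E) = (case P' of (G, E) \<Rightarrow> sym_diff (edges G) E)"
    obtain G E where P_eq: "P = (G, E)" by (cases P)
    obtain G' E' where P'_eq: "P' = (G', E')" by (cases P')
    note PE = P_eq P'_eq
    have in\<G>: "G \<in> \<G>" "G' \<in> \<G>" and inD: "E \<in> D" "E' \<in> D"
      using P by (simp_all add: PE)
    have eq: "sym_diff (edges G) E = sym_diff (edges G') E'"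
      using PP' by (simp only: PE prod.case)
    have on: "G \<in> graphs_on n" "G' \<in> graphs_on n"
      using in\<G> good by (auto simp: good_family_def)
    have iso: "n \<notin> e" if "e \<in> E \<union> E'" for e
      using that inD \<open>n \<ge> 2\<close> by (fastforce simp: D_def nsets_def)
    have "G = G'"
    proof (rule ccontr)
      assume neq: "G \<noteq> G'"
      let ?H = "graph_sym_diff G G'"
      have "?H \<in> ham_path_graphs"
        using neq in\<G> good unfolding good_family_def by blast
      then obtain e where e: "e \<in> edges ?H" "n \<in> e"
        using no_isolated_vertex_if_ham_path[of ?H n n] graph_sym_diff_graphs_on[OF on] \<open>n \<ge> 2\<close>
        by auto
      have "edges ?H \<subseteq> E \<union> E'"
        using eq unfolding graph_sym_diff_def snd_conv by blast
      with e iso show False by blast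
    qed
    have "E = E'"
      using eq unfolding \<open>G = G'\<close> by (rule sym_diff_left_imp_eq)
    with \<open>G = G'\<close> show "P = P'" by (simp add: PE)
  qed
  moreover have "(\<lambda>(G, E). sym_diff (edges G) E) ` (\<G> \<times> D) \<subseteq> Pow ([{1..n}]\<^bsup>2\<^esup>)"
  proof -
    have "[{1..n-1}]\<^bsup>2\<^esup> \<subseteq> [{1..n}]\<^bsup>2\<^esup>" by (intro nsets_mono) auto
    then have "E \<subseteq> [{1..n}]\<^bsup>2\<^esup>" if "E \<in> D" for E
      using that by (simp add: D_def)
    moreover have "edges G \<subseteq> [{1..n}]\<^bsup>2\<^esup>" if "G \<in> \<G>" for G
    proof -
      have "G \<in> graphs_on n" using good that by (auto simp: good_family_def)
      then show ?thesis by (auto simp: graphs_on_def simple_graph_def)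
    qed
    ultimately show ?thesis by blast
  qed
  ultimately have "card (\<G> \<times> D) \<le> card (Pow ([{1..n}]\<^bsup>2\<^esup>))"
    by (intro card_inj_on_le) (auto simp: finite_imp_finite_nsets)
  then have "card \<G> * 2 ^ ((n - 1) choose 2) \<le> 2 ^ (n choose 2)"
    by (simp add: card_cartesian_product D_def card_Pow finite_imp_finite_nsets)
  also have "n choose 2 = (n - 1) + ((n - 1) choose 2)"
    using \<open>n \<ge> 2\<close> by (cases n) (auto simp: numeral_2_eq_2)
  finally show ?thesis by (simp add: power_add)
qed

section \<open>Codes from edge classes\<close>

lemma sym_diff_UNION_disjoint:
  assumes "\<And>i j. i \<in> I \<Longrightarrow> j \<in> I \<Longrightarrow> i \<noteq> j \<Longrightarrow> M i \<inter> M j = {}" "J \<subseteq> I" "K \<subseteq> I"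
  shows "sym_diff (\<Union>i\<in>J. M i) (\<Union>i\<in>K. M i) = (\<Union>i\<in>sym_diff J K. M i)"
proof -
  have *: "(\<Union>i\<in>J. M i) - (\<Union>i\<in>K. M i) = (\<Union>i\<in>J - K. M i)" if "J \<subseteq> I" "K \<subseteq> I" for J K
    using assms(1) that by blast
  show ?thesis
    using *[OF assms(2,3)] *[OF assms(3,2)] by auto
qed

lemma card_even_subsets:
  assumes "finite I" "I \<noteq> {}"
  shows "card {J. J \<subseteq> I \<and> even (card J)} = 2 ^ (card I - 1)"
proof -
  let ?E = "{J. J \<subseteq> I \<and> even (card J)}" and ?O = "{J. J \<subseteq> I \<and> odd (card J)}"
  have "card ?E = card ?O"
    using card_subsupersets_even_odd[of I "{}"] assms by auto
  moreover have "card ?E + card ?O = card (?E \<union> ?O)"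
    using assms(1) by (intro card_Un_disjoint[symmetric]) auto
  moreover have "?E \<union> ?O = Pow I" by auto
  ultimately have "2 * card ?E = 2 ^ card I"
    using assms(1) by (simp add: card_Pow)
  also have "\<dots> = 2 * 2 ^ (card I - 1)"
    using assms by (metis card_gt_0_iff power_minus_mult mult.commute)
  finally show ?thesis by simp
qed

lemma even_sym_diff_two_elements:
  fixes J K :: "'a set"
  assumes "finite J" "finite K" "even (card J)" "even (card K)" "J \<noteq> K"
  obtains i j where "i \<in> sym_diff J K" "j \<in> sym_diff J K" "i \<noteq> j"
proof -
  have card_split: "card A = card (A - B) + card (A \<inter> B)" if "finite A" for A B :: "'a set"
    using that card_Diff_subset_Int[of A B] card_mono[of A "A \<inter> B"] by simp
  have "card J = card (J - K) + card (J \<inter> K)" "card K = card (K - J) + card (J \<inter> K)"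
    using card_split[OF assms(1), of K] card_split[OF assms(2), of J] by (simp_all only: Int_commute)
  moreover have "card (sym_diff J K) = card (J - K) + card (K - J)"
    using assms(1,2) by (intro card_Un_disjoint) auto
  ultimately have "even (card (sym_diff J K))"
    using assms(3,4) by presburger
  moreover have "card (sym_diff J K) \<noteq> 0"
    using assms by auto
  ultimately have "\<not> card (sym_diff J K) \<le> Suc 0"
    by presburger
  moreover have "finite (sym_diff J K)"
    using assms(1,2) by simp
  ultimately have "\<exists>i\<in>sym_diff J K. \<exists>j\<in>sym_diff J K. i \<noteq> j"
    by (simp only: card_le_Suc0_iff_eq) (simp only: bex_simps ball_simps not_all)
  then show thesis
    using that by metis
qed

text \<open>The code consists of the unions of an even number of classes. Since the classes are disjoint,
  the symmetric difference of two words is the union over the symmetric difference of the index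
  sets, which is of even size too and hence has two elements as soon as it is nonempty.\<close>

lemma good_family_of_edge_classes:
  fixes M :: "'i \<Rightarrow> nat set set"
  assumes fin: "finite I" and n: "n \<ge> 2" "card I = n"
    and sub: "\<And>i. i \<in> I \<Longrightarrow> M i \<subseteq> [{1..n}]\<^bsup>2\<^esup>"
    and disj: "\<And>i j. i \<in> I \<Longrightarrow> j \<in> I \<Longrightarrow> i \<noteq> j \<Longrightarrow> M i \<inter> M j = {}"
    and ham: "\<And>i j. i \<in> I \<Longrightarrow> j \<in> I \<Longrightarrow> i \<noteq> j \<Longrightarrow> \<exists>xs. distinct xs \<and> set xs = {1..n} \<and>
       (\<forall>k. Suc k < length xs \<longrightarrow> {xs ! k, xs ! Suc k} \<in> M i \<union> M j)"
  shows "\<exists>\<G>. good_family ham_path_graphs n \<G> \<and> card \<G> = 2 ^ (n - 1)"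
proof -
  define \<J> where "\<J> = {J. J \<subseteq> I \<and> even (card J)}"
  define C where "C J = ({1..n}, \<Union>i\<in>J. M i)" for J
  have on: "C J \<in> graphs_on n" if "J \<in> \<J>" for J
    using that sub by (fastforce simp: C_def \<J>_def graphs_on_def simple_graph_def)
  have ham_diff: "graph_sym_diff (C J) (C K) \<in> ham_path_graphs"
    if JK: "J \<in> \<J>" "K \<in> \<J>" "J \<noteq> K" for J K
  proof -
    have "finite J" "finite K"
      using JK fin by (auto simp: \<J>_def intro: finite_subset)
    then obtain i j where ij: "i \<in> sym_diff J K" "j \<in> sym_diff J K" "i \<noteq> j"
      using JK even_sym_diff_two_elements[of J K] unfolding \<J>_def by blast
    have E: "edges (graph_sym_diff (C J) (C K)) = (\<Union>i\<in>sym_diff J K. M i)"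
      unfolding graph_sym_diff_def C_def snd_conv
      using JK by (intro sym_diff_UNION_disjoint[OF disj]) (auto simp: \<J>_def)
    have "i \<in> I" "j \<in> I" using ij JK by (auto simp: \<J>_def)
    from ham[OF this ij(3)] obtain xs where xs: "distinct xs" "set xs = {1..n}"
      "\<forall>k. Suc k < length xs \<longrightarrow> {xs ! k, xs ! Suc k} \<in> M i \<union> M j" by blast
    have "M i \<union> M j \<subseteq> edges (graph_sym_diff (C J) (C K))"
      unfolding E using ij by blast
    then show ?thesis
      using xs n ham_path_graphs_iff[OF graph_sym_diff_graphs_on[OF on on, OF JK(1,2)]]
      by (auto intro!: exI[of _ xs] simp del: Un_iff)
  qed
  have "inj_on C \<J>"
  proof (rule inj_onI, rule ccontr)
    fix J K assume JK: "J \<in> \<J>" "K \<in> \<J>" "C J = C K" "J \<noteq> K"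
    have "edges (graph_sym_diff (C J) (C K)) = {}"
      using JK(3) by (simp add: graph_sym_diff_def)
    with no_isolated_vertex_if_ham_path[OF graph_sym_diff_graphs_on[OF on on] ham_diff, of J K n]
    show False using JK n by auto
  qed
  moreover have "I \<noteq> {}" using n by auto
  ultimately have "card (C ` \<J>) = 2 ^ (n - 1)"
    using card_even_subsets[OF fin] n(2) by (simp add: card_image \<J>_def)
  moreover have "good_family ham_path_graphs n (C ` \<J>)"
    using on ham_diff unfolding good_family_def by blast
  ultimately show ?thesis by blast
qed

section \<open>Perfect one-factorizations\<close>

text \<open>A perfect matching is given as the fixed-point-free involution that exchanges the ends of its
  edges. The factors are disjoint and there are \<open>card V - 1\<close> of them, so they cover all
  edges of the complete graph. The union of two of them is a 2-regular graph; it is a Hamiltonian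
  cycle iff it is connected, and connectedness is expressed by the absence of proper nonempty sets
  that are closed under both involutions, which is easy to verify algebraically.\<close>

definition perfect_one_factorization :: "'v set \<Rightarrow> 'i set \<Rightarrow> ('i \<Rightarrow> 'v \<Rightarrow> 'v) \<Rightarrow> bool" where
  "perfect_one_factorization V I \<phi> \<longleftrightarrow>
     finite V \<and> finite I \<and> card V = Suc (card I) \<and>
     (\<forall>i\<in>I. \<forall>x\<in>V. \<phi> i x \<in> V \<and> \<phi> i x \<noteq> x \<and> \<phi> i (\<phi> i x) = x) \<and>
     (\<forall>i\<in>I. \<forall>j\<in>I. i \<noteq> j \<longrightarrow>
        (\<forall>x\<in>V. \<phi> i x \<noteq> \<phi> j x) \<and>
        (\<forall>S\<subseteq>V. S \<noteq> {} \<longrightarrow> \<phi> i ` S \<subseteq> S \<longrightarrow> \<phi> j ` S \<subseteq> S \<longrightarrow> S = V))"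

text \<open>The sum of ones over \<open>S\<close> cancels in pairs in the field with two elements.\<close>

lemma even_card_if_fixpoint_free_involution:
  assumes "\<And>x. x \<in> S \<Longrightarrow> h x \<in> S" "\<And>x. x \<in> S \<Longrightarrow> h (h x) = x" "\<And>x. x \<in> S \<Longrightarrow> h x \<noteq> x"
  shows "even (card S)"
proof -
  have "(\<Sum>x\<in>S. 1 :: bit) = 0"
    using assms by (intro sum_involution_eq_0[of _ _ h]) auto
  then have "of_nat (card S) = (0 :: bit)" by simp
  moreover have "of_nat n = (of_bool (odd n) :: bit)" for n
    by (induction n) auto
  ultimately show ?thesis by (auto split: if_splits)
qed

text \<open>Walk away from \<open>z\<close> along \<open>f\<close> and \<open>g\<close> in alternation, starting with \<open>f\<close>, and stop before the
  first repetition. The vertices visited, \<open>z\<close> included, form a set that contains both neighbours of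
  each of its members, except perhaps \<open>g z\<close>, so by connectedness it is everything once \<open>g z\<close> is
  known to belong to it. Parity
  gives this: otherwise \<open>f\<close> would match the vertices of the walk with \<open>z\<close> and \<open>g\<close> without \<open>z\<close>.\<close>

lemma ham_path_of_two_involutions:
  fixes f g :: "'v \<Rightarrow> 'v"
  assumes "finite V"
    and f: "\<And>x. x \<in> V \<Longrightarrow> f x \<in> V" "\<And>x. x \<in> V \<Longrightarrow> f x \<noteq> x" "\<And>x. x \<in> V \<Longrightarrow> f (f x) = x"
    and g: "\<And>x. x \<in> V \<Longrightarrow> g x \<in> V" "\<And>x. x \<in> V \<Longrightarrow> g x \<noteq> x" "\<And>x. x \<in> V \<Longrightarrow> g (g x) = x"
    and conn: "\<And>S. S \<subseteq> V \<Longrightarrow> S \<noteq> {} \<Longrightarrow> f ` S \<subseteq> S \<Longrightarrow> g ` S \<subseteq> S \<Longrightarrow> S = V"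
    and "z \<in> V"
  shows "\<exists>xs. distinct xs \<and> set xs = V - {z} \<and>
    (\<forall>i. Suc i < length xs \<longrightarrow> xs ! Suc i = f (xs ! i) \<or> xs ! Suc i = g (xs ! i))"
proof -
  define w where "w = rec_nat (f z) (\<lambda>k x. if even k then g x else f x)"
  have w0: "w 0 = f z" and wSuc: "w (Suc k) = (if even k then g (w k) else f (w k))" for k
    by (simp_all add: w_def)
  have wV: "w k \<in> V" for k
    by (induction k) (use f g \<open>z \<in> V\<close> in \<open>auto simp: w0 wSuc\<close>)
  have "\<exists>m. w (Suc m) \<in> insert z (w ` {..m})"
  proof (rule ccontr)
    assume *: "\<not> ?thesis"
    have "inj w"
    proof (rule linorder_injI)
      fix i j :: nat assume "i < j"
      then obtain k where "j = Suc k" "i \<le> k" by (cases j) auto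
      then show "w i \<noteq> w j" using * by (metis atMost_iff image_eqI insertCI)
    qed
    then have "infinite (range w)" by (simp add: finite_image_iff)
    then show False using \<open>finite V\<close> wV by (meson finite_subset image_subsetI)
  qed
  then obtain m where m: "w (Suc m) \<in> insert z (w ` {..m})"
    and least: "\<And>k. k < m \<Longrightarrow> w (Suc k) \<notin> insert z (w ` {..k})"
    unfolding exists_least_iff[of "\<lambda>m. w (Suc m) \<in> insert z (w ` {..m})"] by blast
  define S where "S = insert z (w ` {..m})"
  have SV: "S \<subseteq> V" using wV \<open>z \<in> V\<close> by (auto simp: S_def)
  have w_ne: "w k \<noteq> z" if "k \<le> m" for k
    using that least f(2)[OF \<open>z \<in> V\<close>] by (cases k) (auto simp: w0)
  have w_inj: "inj_on w {..m}"
  proof (rule linorder_inj_onI)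
    fix i j assume "i < j" "j \<in> {..m}"
    then obtain k where "j = Suc k" "i \<le> k" "k < m" by (cases j) auto
    then show "w i \<noteq> w j" using least[of k] by (metis atMost_iff image_eqI insertCI)
  qed auto
  have next_S: "w (Suc k) \<in> S" if "k \<le> m" for k
    using that m by (cases "k = m") (auto simp: S_def)
  have f_w: "f (w k) \<in> S" if k: "k \<le> m" for k
  proof (cases k)
    case 0
    then show ?thesis using f(3) \<open>z \<in> V\<close> by (simp add: w0 S_def)
  next
    case (Suc l)
    show ?thesis
    proof (cases "even l")
      case True
      then have "w (Suc k) = f (w k)" using Suc by (simp add: wSuc)
      then show ?thesis using next_S[OF k] by simp
    next
      case False
      then have "f (w k) = w l" using f(3) wV by (simp add: Suc wSuc)
      then show ?thesis using k Suc by (simp add: S_def)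
    qed
  qed
  have f_S: "f ` S \<subseteq> S"
    using f_w by (auto simp: S_def w0 intro!: imageI)
      (metis S_def atMost_iff image_eqI insertCI le0 w0)
  have g_w: "g (w k) \<in> S" if k: "k \<le> m" for k
  proof (cases "even k")
    case True
    then show ?thesis using next_S[OF k] by (simp add: wSuc[of k])
  next
    case False
    then obtain l where l: "k = Suc l" "even l" by (cases k) auto
    then have "g (w k) = w l" using g(3) wV by (simp add: wSuc)
    then show ?thesis using k l by (simp add: S_def)
  qed
  \<comment> \<open>Otherwise \<open>f\<close> acts on \<open>S\<close> and \<open>g\<close> on \<open>S - {z}\<close>, and both would have even size.\<close>
  have gz: "g z \<in> S"
  proof (rule ccontr)
    assume gz: "g z \<notin> S"
    have "even (card S)"
      using f f_S SV by (intro even_card_if_fixpoint_free_involution[of _ f]) auto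
    moreover have "even (card (w ` {..m}))"
    proof (rule even_card_if_fixpoint_free_involution[of _ g])
      fix x assume x: "x \<in> w ` {..m}"
      then have "g x \<in> S" "x \<in> S" using g_w by (auto simp: S_def)
      moreover have "g x \<noteq> z"
        using gz g(3)[of x] \<open>x \<in> S\<close> SV by auto
      ultimately show "g x \<in> w ` {..m}" by (auto simp: S_def)
    qed (use wV g in auto)
    moreover have "card S = Suc (card (w ` {..m}))"
      unfolding S_def using w_ne by (intro card_insert_disjoint) force+
    ultimately show False by simp
  qed
  have "g ` S \<subseteq> S" using gz g_w by (auto simp: S_def)
  then have "S = V" using conn f_S SV by (auto simp: S_def)
  then have "set (map w [0..<Suc m]) = V - {z}"
    using w_ne by (auto simp: S_def atLeast0LessThan lessThan_Suc_atMost simp del: upt_Suc)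
  moreover have "distinct (map w [0..<Suc m])"
    using w_inj by (simp add: distinct_map atLeast0LessThan lessThan_Suc_atMost del: upt_Suc)
  ultimately show ?thesis
    by (intro exI[of _ "map w [0..<Suc m]"]) (auto simp: wSuc simp del: upt_Suc)
qed

text \<open>The deleted vertex is an arbitrary \<open>z\<close>; the others are renamed to \<open>{1..n}\<close>.\<close>

lemma max_good_if_perfect_one_factorization:
  assumes P: "perfect_one_factorization V I \<phi>" and n: "card I = n" "n \<ge> 2"
  shows "max_good ham_path_graphs n = 2 ^ (n - 1)"
proof -
  have fin: "finite V" "finite I" and card: "card V = Suc n"
    using P n by (auto simp: perfect_one_factorization_def)
  have \<phi>: "\<phi> i x \<in> V" "\<phi> i x \<noteq> x" "\<phi> i (\<phi> i x) = x" if "i \<in> I" "x \<in> V" for i x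
    using P that by (auto simp: perfect_one_factorization_def)
  have \<phi>2: "\<phi> i x \<noteq> \<phi> j x" if "i \<in> I" "j \<in> I" "i \<noteq> j" "x \<in> V" for i j x
    using P that by (auto simp: perfect_one_factorization_def)
  have conn: "S = V" if "i \<in> I" "j \<in> I" "i \<noteq> j" "S \<subseteq> V" "S \<noteq> {}" "\<phi> i ` S \<subseteq> S" "\<phi> j ` S \<subseteq> S"
    for i j S
    using P that unfolding perfect_one_factorization_def by blast
  obtain z where z: "z \<in> V" using card by fastforce
  have "card (V - {z}) = card {1..n}" using card z fin by simp
  then obtain \<iota> where \<iota>: "bij_betw \<iota> (V - {z}) {1..n}"
    using fin by (meson finite_Diff finite_atLeastAtMost finite_same_card_bij)
  have \<iota>_eq: "\<iota> x = \<iota> y \<longleftrightarrow> x = y" if "x \<in> V - {z}" "y \<in> V - {z}" for x y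
    using that \<iota> by (meson bij_betw_imp_inj_on inj_on_eq_iff)
  have \<iota>_in: "\<iota> x \<in> {1..n}" if "x \<in> V - {z}" for x
    using that \<iota> by (meson bij_betwE)
  \<comment> \<open>The matching \<open>\<phi> i\<close> without its edge at \<open>z\<close>.\<close>
  define M where "M i = {{\<iota> x, \<iota> (\<phi> i x)} | x. x \<in> V - {z} \<and> \<phi> i x \<in> V - {z}}" for i
  have "\<exists>\<G>. good_family ham_path_graphs n \<G> \<and> card \<G> = 2 ^ (n - 1)"
  proof (rule good_family_of_edge_classes[OF fin(2) n(2,1), of M])
    fix i assume "i \<in> I"
    then show "M i \<subseteq> [{1..n}]\<^bsup>2\<^esup>"
      using \<iota>_in \<iota>_eq \<phi>(2) unfolding M_def by (smt (verit, best) DiffD1 doubleton_in_nsets_2 mem_Collect_eq subsetI)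
  next
    fix i j assume ij: "i \<in> I" "j \<in> I" "i \<noteq> j"
    show "M i \<inter> M j = {}"
    proof (rule ccontr)
      assume "M i \<inter> M j \<noteq> {}"
      then obtain x y where xy: "x \<in> V - {z}" "\<phi> i x \<in> V - {z}" "y \<in> V - {z}" "\<phi> j y \<in> V - {z}"
        "{\<iota> x, \<iota> (\<phi> i x)} = {\<iota> y, \<iota> (\<phi> j y)}"
        unfolding M_def by blast
      then have "(x = y \<and> \<phi> i x = \<phi> j y) \<or> (x = \<phi> j y \<and> \<phi> i x = y)"
        by (simp add: doubleton_eq_iff \<iota>_eq)
      then have "\<phi> i x = \<phi> j x" using \<phi>(3)[OF ij(2)] xy by auto
      then show False using \<phi>2[OF ij] xy by auto
    qed
    obtain xs where xs: "distinct xs" "set xs = V - {z}"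
      "\<And>k. Suc k < length xs \<Longrightarrow> xs ! Suc k = \<phi> i (xs ! k) \<or> xs ! Suc k = \<phi> j (xs ! k)"
      using ham_path_of_two_involutions[of V "\<phi> i" "\<phi> j" z] fin z \<phi>[OF ij(1)] \<phi>[OF ij(2)] conn[OF ij]
      by auto
    have "{\<iota> (xs ! k), \<iota> (xs ! Suc k)} \<in> M i \<union> M j" if k: "Suc k < length xs" for k
    proof -
      have "xs ! k \<in> V - {z}" "xs ! Suc k \<in> V - {z}"
        using k xs(2) nth_mem[of k xs] nth_mem[of "Suc k" xs] by auto
      then show ?thesis using xs(3)[OF k] unfolding M_def by auto
    qed
    moreover have "distinct (map \<iota> xs)" "set (map \<iota> xs) = {1..n}"
      using xs(1,2) \<iota> by (auto simp: distinct_map bij_betw_def)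
    ultimately show "\<exists>xs. distinct xs \<and> set xs = {1..n} \<and>
       (\<forall>k. Suc k < length xs \<longrightarrow> {xs ! k, xs ! Suc k} \<in> M i \<union> M j)"
      by (intro exI[of _ "map \<iota> xs"]) auto
  qed
  then have "2 ^ (n - 1) \<in> {card \<G> | \<G>. good_family ham_path_graphs n \<G>}"
    by force
  then show ?thesis
    unfolding max_good_def using card_good_family_le[OF n(2)]
    by (intro Max_eqI finite_good_family_cards) auto
qed

section \<open>Reflections and shifts modulo a prime\<close>

text \<open>Reflections are indexed by their fixed point \<open>c\<close> rather than by the residue \<open>2 * c\<close>; as
  \<open>p\<close> is odd, this loses none of them and avoids halving modulo \<open>p\<close>.\<close>

definition reflect :: "int \<Rightarrow> int \<Rightarrow> int \<Rightarrow> int" where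
  "reflect p c x = (2 * c - x) mod p"

lemma shift_closed_imp_full:
  fixes p d :: int
  assumes "p > 0" "coprime d p" "T \<subseteq> {0..<p}" "T \<noteq> {}"
    and closed: "\<And>x. x \<in> T \<Longrightarrow> (x + d) mod p \<in> T"
  shows "T = {0..<p}"
proof -
  obtain x where x: "x \<in> T" using assms by blast
  have iter: "(x + int k * d) mod p \<in> T" for k
  proof (induction k)
    case 0
    then show ?case using x assms(3) by (auto simp: subset_iff)
  next
    case (Suc k)
    then show ?case using closed[OF Suc] by (simp add: mod_simps algebra_simps)
  qed
  have "y \<in> T" if y: "y \<in> {0..<p}" for y
  proof -
    obtain u where u: "[d * u = 1] (mod p)"
      using cong_solve_coprime_int[OF assms(2)] by blast
    \<comment> \<open>From \<open>x\<close>, the residue \<open>y\<close> is reached after \<open>(y - x) / d\<close> shifts.\<close>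
    define k where "k = nat ((u * (y - x)) mod p)"
    have "[int k * d = (u * (y - x)) * d] (mod p)"
      using assms(1) by (auto simp: k_def cong_def mod_simps)
    also have "(u * (y - x)) * d = (d * u) * (y - x)" by simp
    also have "[(d * u) * (y - x) = 1 * (y - x)] (mod p)"
      using u by (rule cong_scalar_right)
    finally have "[x + int k * d = x + (y - x)] (mod p)"
      by (intro cong_add) (auto simp: cong_refl)
    then show ?thesis using iter[of k] y by (simp add: cong_def)
  qed
  then show ?thesis using assms(3) by blast
qed

lemma coprime_diff_residues:
  fixes p d e :: int
  assumes "prime p" "odd p" "d \<in> {0..<p}" "e \<in> {0..<p}" "d \<noteq> e"
  shows "coprime (d - e) p" "coprime (2 * (d - e)) p"
proof -
  have "\<not> p dvd d - e"
    using assms(3-5) by (simp add: mod_eq_dvd_iff[symmetric])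
  then show *: "coprime (d - e) p"
    using assms(1) by (simp add: prime_imp_coprime coprime_commute)
  show "coprime (2 * (d - e)) p"
    using * assms(2) unfolding coprime_mult_left_iff coprime_left_2_iff_odd by blast
qed

lemma reflect_eq_iff:
  assumes "prime p" "odd p" "a \<in> {0..<p}" "b \<in> {0..<p}"
  shows "reflect p a x = reflect p b x \<longleftrightarrow> a = b"
proof
  assume "reflect p a x = reflect p b x"
  then have "p dvd 2 * (a - b)"
    by (simp add: reflect_def mod_eq_dvd_iff algebra_simps)
  then show "a = b"
    using coprime_diff_residues(2)[OF assms] assms(1) by (metis coprime_common_divisor dvd_refl not_prime_unit)
qed simp

lemma reflect_in: "p > 0 \<Longrightarrow> reflect p c x \<in> {0..<p}"
  by (simp add: reflect_def)

lemma reflect_reflect: "x \<in> {0..<p} \<Longrightarrow> reflect p c (reflect p c x) = x"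
  by (simp add: reflect_def mod_simps)

lemma reflect_eq_self_iff:
  assumes "prime p" "odd p" "c \<in> {0..<p}" "x \<in> {0..<p}"
  shows "reflect p c x = x \<longleftrightarrow> x = c"
  using reflect_eq_iff[OF assms(1,2), of c x x] assms by (auto simp: reflect_def)

lemma reflect_eq_center_iff:
  assumes "prime p" "odd p" "c \<in> {0..<p}" "x \<in> {0..<p}"
  shows "reflect p c x = c \<longleftrightarrow> x = c"
  using assms reflect_eq_self_iff reflect_reflect by metis

text \<open>The product of the reflections at \<open>a\<close> and \<open>b\<close> is the shift by \<open>2 * (a - b)\<close>.\<close>

lemma reflections_closed_imp_full:
  assumes "prime p" "odd p" "a \<in> {0..<p}" "b \<in> {0..<p}" "a \<noteq> b" "T \<subseteq> {0..<p}" "T \<noteq> {}"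
    and closed: "\<And>x. x \<in> T \<Longrightarrow> reflect p a x \<in> T" "\<And>x. x \<in> T \<Longrightarrow> reflect p b x \<in> T"
  shows "T = {0..<p}"
proof (rule shift_closed_imp_full)
  show "(x + 2 * (a - b)) mod p \<in> T" if "x \<in> T" for x
  proof -
    have "(x + 2 * (a - b)) mod p = reflect p a (reflect p b x)"
      by (simp add: reflect_def mod_simps algebra_simps)
    then show ?thesis using closed that by simp
  qed
qed (use assms coprime_diff_residues prime_gt_0_int in auto)

section \<open>A perfect one-factorization on p + 1 vertices\<close>

text \<open>\<^const>\<open>None\<close> is the point at infinity.\<close>

definition point_factor :: "int \<Rightarrow> int \<Rightarrow> int option \<Rightarrow> int option" where
  "point_factor p c v = (case v of None \<Rightarrow> Some c
     | Some x \<Rightarrow> if x = c then None else Some (reflect p c x))"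

text \<open>The residues in a closed set are closed under the full reflections, the detour through infinity
  affecting only a fixed point; so there is nothing more to show than for two reflections of
  the residues.\<close>

lemma perfect_one_factorization_prime:
  assumes "prime p" "odd p"
  shows "perfect_one_factorization (insert None (Some ` {0..<p})) {0..<p} (point_factor p)"
    (is "perfect_one_factorization ?V _ _")
  unfolding perfect_one_factorization_def
proof (intro conjI ballI impI allI)
  note p = assms prime_gt_0_int[OF assms(1)]
  note r = reflect_in[OF p(3)] reflect_reflect reflect_eq_self_iff[OF p(1,2)]
    reflect_eq_center_iff[OF p(1,2)] reflect_eq_iff[OF p(1,2)]
  show "finite ?V" "finite {0..<p}" by auto
  show "card ?V = Suc (card {0..<p})" by (simp add: card_insert_if card_image)
  fix a assume a: "a \<in> {0..<p}"
  {
    fix v assume v: "v \<in> ?V"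
    show "point_factor p a v \<in> ?V" "point_factor p a v \<noteq> v" "point_factor p a (point_factor p a v) = v"
      using v a r by (auto simp: point_factor_def split: option.splits)
  }
  fix b assume b: "b \<in> {0..<p}" "a \<noteq> b"
  {
    fix v assume v: "v \<in> ?V"
    show "point_factor p a v \<noteq> point_factor p b v"
      using v a b r by (auto simp: point_factor_def split: option.splits)
  }
  fix S assume S: "S \<subseteq> ?V" "S \<noteq> {}" "point_factor p a ` S \<subseteq> S" "point_factor p b ` S \<subseteq> S"
  define T where "T = {x. Some x \<in> S}"
  have T_refl: "reflect p c x \<in> T" if "x \<in> T" "point_factor p c ` S \<subseteq> S" "c \<in> {0..<p}" for c x
  proof (cases "x = c")
    case True
    then show ?thesis using r(3)[of c c] that by simp
  next
    case False
    then have "point_factor p c (Some x) = Some (reflect p c x)" by (simp add: point_factor_def)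
    then show ?thesis using that unfolding T_def by (metis image_subset_iff mem_Collect_eq)
  qed
  have "T \<noteq> {}"
  proof (cases "None \<in> S")
    case True
    then have "point_factor p a None \<in> S" using S by blast
    then show ?thesis by (auto simp: T_def point_factor_def)
  next
    case False
    then obtain x where "Some x \<in> S" using S(2) by (metis all_not_in_conv not_None_eq)
    then show ?thesis by (auto simp: T_def)
  qed
  then have T: "T = {0..<p}"
    using reflections_closed_imp_full[OF assms a b, of T] T_refl S a b by (auto simp: T_def)
  then have "a \<in> T" using a by simp
  then have "Some a \<in> S" by (simp add: T_def)
  then have "point_factor p a (Some a) \<in> S"
    using S(3) by blast
  then show "S = ?V"
    using T S(1) by (auto simp: T_def point_factor_def)
qed

section \<open>A perfect one-factorization on 2p vertices\<close>

text \<open>The index \<open>(c, True)\<close> stands for the reflection at \<open>c\<close> in both copies of the residues, and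
  \<open>(d, False)\<close> for the shift by \<open>d\<close> from the copy \<open>False\<close> to the copy \<open>True\<close>. The two copies of
  \<open>c\<close> are already matched by the reflection at \<open>c\<close>, so the shift by \<open>0\<close> is left out.\<close>

definition double_factor :: "int \<Rightarrow> int \<times> bool \<Rightarrow> int \<times> bool \<Rightarrow> int \<times> bool" where
  "double_factor p i v = (case (i, v) of
      ((c, True), (x, s)) \<Rightarrow> if x = c then (c, \<not> s) else (reflect p c x, s)
    | ((d, False), (x, s)) \<Rightarrow> (if s then (x - d) mod p else (x + d) mod p, \<not> s))"

text \<open>For connectedness there are three kinds of pairs. Two reflections act on each copy as in
  the previous construction, and either of them links the copies at its fixed point. Two shifts,
  one forth and one back, move the copy \<open>False\<close> by their difference. A reflection and a shift by
  \<open>d\<close> move it by \<open>2 * d\<close>: shift forth, reflect, shift back, reflect.\<close>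

lemma perfect_one_factorization_double_prime:
  assumes "prime p" "odd p"
  shows "perfect_one_factorization ({0..<p} \<times> UNIV) ({0..<p} \<times> UNIV - {(0, False)}) (double_factor p)"
    (is "perfect_one_factorization ?V ?I _")
  unfolding perfect_one_factorization_def
proof (intro conjI ballI impI allI)
  note p = assms prime_gt_0_int[OF assms(1)]
  note r = reflect_in[OF p(3)] reflect_reflect reflect_eq_self_iff[OF p(1,2)]
    reflect_eq_center_iff[OF p(1,2)] reflect_eq_iff[OF p(1,2)]
  show "finite ?V" "finite ?I" by auto
  show "card ?V = Suc (card ?I)"
    using p(3) by (subst card_Suc_Diff1) auto
  have shift_eq: "(x + d) mod p = (x + e) mod p \<longleftrightarrow> d = e" "(x - d) mod p = (x - e) mod p \<longleftrightarrow> d = e"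
    if "d \<in> {0..<p}" "e \<in> {0..<p}" for d e x
    using that by (auto simp: mod_eq_dvd_iff) (auto simp: mod_eq_dvd_iff[symmetric])
  have shift_ne: "(x + d) mod p \<noteq> x" "(x - d) mod p \<noteq> x" if "d \<in> {0..<p}" "d \<noteq> 0" "x \<in> {0..<p}" for d x
    using shift_eq[OF that(1), of 0 x] that p(3) by auto
  fix i assume i: "i \<in> ?I"
  {
    fix v assume v: "v \<in> ?V"
    show "double_factor p i v \<in> ?V" "double_factor p i v \<noteq> v" "double_factor p i (double_factor p i v) = v"
    proof -
      obtain a u x s where ix: "i = (a, u)" "v = (x, s)" by (cases i, cases v) auto
      have x: "x \<in> {0..<p}" "a \<in> {0..<p}" using v i by (auto simp: ix)
      show "double_factor p i v \<in> ?V" "double_factor p i v \<noteq> v"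
        "double_factor p i (double_factor p i v) = v"
        using x p(3) r(1)[of a x] r(2)[OF x(1), of a] r(3,4)[OF x(2,1)]
        by (cases u; cases s; simp add: ix double_factor_def mod_simps)+
    qed
  }
  fix j assume j: "j \<in> ?I" "i \<noteq> j"
  {
    fix v assume v: "v \<in> ?V"
    show "double_factor p i v \<noteq> double_factor p j v"
    proof -
      obtain a u b t x s where ix: "i = (a, u)" "j = (b, t)" "v = (x, s)"
        by (cases i, cases j, cases v) auto
      have x: "x \<in> {0..<p}" "a \<in> {0..<p}" "b \<in> {0..<p}" "u = t \<Longrightarrow> a \<noteq> b"
        "\<not> u \<Longrightarrow> a \<noteq> 0" "\<not> t \<Longrightarrow> b \<noteq> 0"
        using v i j by (auto simp: ix)
      have R: "reflect p a x = reflect p b x \<longleftrightarrow> a = b" using r(5) x by blast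
      consider "u" "t" | "\<not> u" "\<not> t" | "u" "\<not> t" | "\<not> u" "t" by blast
      then show ?thesis
      proof cases
        case 1
        then show ?thesis using R x(4) by (simp add: ix double_factor_def)
      next
        case 2
        then show ?thesis using shift_eq[OF x(2,3), of x] x(4) by (simp add: ix double_factor_def)
      next
        case 3
        then show ?thesis using shift_ne[OF x(3) x(6) x(1)] by (auto simp: ix double_factor_def)
      next
        case 4
        then show ?thesis using shift_ne[OF x(2) x(5) x(1)] by (auto simp: ix double_factor_def)
      qed
    qed
  }
  fix S assume S: "S \<subseteq> ?V" "S \<noteq> {}" "double_factor p i ` S \<subseteq> S" "double_factor p j ` S \<subseteq> S"
  \<comment> \<open>The residues of \<open>S\<close> in the copy \<open>s\<close>.\<close>
  define T where "T s = {x. (x, s) \<in> S}" for s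
  have T_sub: "T s \<subseteq> {0..<p}" for s using S(1) by (auto simp: T_def)
  have "\<exists>s. T s \<noteq> {}" using S(2) by (auto simp: T_def)
  have refl_T: "reflect p c x \<in> T s"
    if "x \<in> T s" "double_factor p (c, True) ` S \<subseteq> S" "c \<in> {0..<p}" for c x s
  proof (cases "x = c")
    case True
    then show ?thesis using r(3)[of c c] that by simp
  next
    case False
    then have "double_factor p (c, True) (x, s) = (reflect p c x, s)" by (simp add: double_factor_def)
    then show ?thesis using that unfolding T_def by (metis image_subset_iff mem_Collect_eq)
  qed
  have up: "(x + d) mod p \<in> T True" if "x \<in> T False" "double_factor p (d, False) ` S \<subseteq> S" for x d
    using that unfolding T_def by (force simp: double_factor_def)
  have down: "(x - d) mod p \<in> T False" if "x \<in> T True" "double_factor p (d, False) ` S \<subseteq> S" for x d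
    using that unfolding T_def by (force simp: double_factor_def)
  have T_False_nonempty: "T False \<noteq> {}" if "double_factor p (d, False) ` S \<subseteq> S" for d
    using \<open>\<exists>s. T s \<noteq> {}\<close> down[OF _ that] by (metis (full_types) all_not_in_conv)
  have full: "S = ?V" if full: "T False = {0..<p}" "T True = {0..<p}"
  proof -
    have "(x, s) \<in> S" if "x \<in> {0..<p}" for x s
    proof -
      have "x \<in> T s" using that full by (cases s) simp_all
      then show ?thesis by (simp add: T_def)
    qed
    then show ?thesis using S(1) by auto
  qed
  have full_if_shift: "S = ?V" if T: "T False = {0..<p}" and d: "double_factor p (d, False) ` S \<subseteq> S" for d
  proof (rule full[OF T])
    have "x \<in> T True" if "x \<in> {0..<p}" for x
      using up[of "(x - d) mod p" d] T d that p(3) by (simp add: mod_simps)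
    then show "T True = {0..<p}" using T_sub by blast
  qed
  have mixed: "S = ?V"
    if c: "double_factor p (c, True) ` S \<subseteq> S" "c \<in> {0..<p}"
      and d: "double_factor p (d, False) ` S \<subseteq> S" "d \<in> {0..<p}" "d \<noteq> 0" for c d
  proof (rule full_if_shift[OF shift_closed_imp_full d(1)])
    show "coprime (2 * d) p"
      using coprime_diff_residues(2)[OF assms d(2), of 0] d(3) p(3) by simp
    show "(x + 2 * d) mod p \<in> T False" if x: "x \<in> T False" for x
    proof -
      have "(x + 2 * d) mod p = reflect p c ((reflect p c ((x + d) mod p) - d) mod p)"
        by (simp add: reflect_def mod_simps algebra_simps)
      then show ?thesis using x c d by (metis refl_T up down)
    qed
  qed (use p T_sub T_False_nonempty[OF d(1)] in auto)
  obtain a s b t where ij: "i = (a, s)" "j = (b, t)" by (cases i, cases j)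
  have ab: "a \<in> {0..<p}" "b \<in> {0..<p}" "s = t \<Longrightarrow> a \<noteq> b" "\<not> s \<Longrightarrow> a \<noteq> 0" "\<not> t \<Longrightarrow> b \<noteq> 0"
    using i j by (auto simp: ij)
  consider "s" "t" | "\<not> s" "\<not> t" | "s" "\<not> t" | "\<not> s" "t" by blast
  then show "S = ?V"
  proof cases
    case 1
    have T_full: "T u = {0..<p}" if "T u \<noteq> {}" for u
      using reflections_closed_imp_full[OF assms ab(1,2), of "T u"] refl_T T_sub that S(3,4) ab 1
      by (auto simp: ij)
    obtain u where u: "T u = {0..<p}" using \<open>\<exists>s. T s \<noteq> {}\<close> T_full by blast
    then have "a \<in> T u" using ab by simp
    then have "(a, u) \<in> S" by (simp add: T_def)
    then have "double_factor p i (a, u) \<in> S" using S by blast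
    then have "T (\<not> u) \<noteq> {}" using 1 by (auto simp: ij T_def double_factor_def)
    then have "T (\<not> u) = {0..<p}" using T_full by blast
    with u full show ?thesis by (cases u) auto
  next
    case 2
    have "T False = {0..<p}"
    proof (rule shift_closed_imp_full)
      show "coprime (a - b) p" using coprime_diff_residues(1)[OF assms ab(1,2)] ab(3) 2 by simp
      show "(x + (a - b)) mod p \<in> T False" if "x \<in> T False" for x
        using down[OF up[OF that], of a b] S 2 by (simp add: ij mod_simps algebra_simps)
    qed (use p T_sub T_False_nonempty[of a] S 2 in \<open>auto simp: ij\<close>)
    then show ?thesis using full_if_shift S 2 by (auto simp: ij)
  next
    case 3
    then show ?thesis using mixed[of a b] S ab by (simp add: ij)
  next
    case 4
    then show ?thesis using mixed[of b a] S ab by (simp add: ij)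
  qed
qed

section \<open>Infinitely many exact values\<close>

theorem theorem5:
  shows "infinite {n::nat. max_good ham_path_graphs n = 2 ^ (n - 1)} \<and>
    (\<forall>p::nat. prime p \<and> odd p \<longrightarrow>
      (\<forall>n. n = p \<or> n = 2 * p - 1 \<longrightarrow> max_good ham_path_graphs n = 2 ^ (n - 1)))"
proof -
  have main: "max_good ham_path_graphs n = 2 ^ (n - 1)"
    if p: "prime p" "odd p" and n: "n = p \<or> n = 2 * p - 1" for p n :: nat
  proof -
    have ip: "prime (int p)" "odd (int p)" using p by auto
    have "p \<ge> 2" using p(1) by (rule prime_ge_2_nat)
    from n show ?thesis
    proof
      assume "n = p"
      then show ?thesis
        using max_good_if_perfect_one_factorization[OF perfect_one_factorization_prime[OF ip]]
          \<open>p \<ge> 2\<close> by simp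
    next
      assume "n = 2 * p - 1"
      moreover have "card ({0..<int p} \<times> UNIV - {(0, False)}) = 2 * p - 1"
        using \<open>p \<ge> 2\<close> by (subst card_Diff_singleton) (auto simp: card_cartesian_product)
      ultimately show ?thesis
        using max_good_if_perfect_one_factorization[OF perfect_one_factorization_double_prime[OF ip]]
          \<open>p \<ge> 2\<close> by simp
    qed
  qed
  have "{p::nat. prime p} - {2} \<subseteq> {n. max_good ham_path_graphs n = 2 ^ (n - 1)}"
    using main primes_dvd_imp_eq two_is_prime_nat by blast
  then have "infinite {n::nat. max_good ham_path_graphs n = 2 ^ (n - 1)}"
    using primes_infinite by (meson finite_subset infinite_remove)
  with main show ?thesis by blast
qed

end
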